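(* Suppose that the $8$ coefficients $c_0,\dots,c_7$ of the monic polynomial $P_8(z)=z^8+\sum_{m=0}^{7}c_m z^m$ are expressed in terms of the $6$ parameters $\alpha_0,\alpha_1,\beta_0,\beta_1,\gamma_0,\gamma_1$ by the $8$ formulas $$c_7=4\alpha_1,$$ $$c_6=4\alpha_0+6\alpha_1^2+2\beta_1,$$ $$c_5=12\alpha_0\alpha_1+4\alpha_1^3+6\alpha_1\beta_1,$$ $$c_4=6\alpha_0\left[\alpha_0+2\alpha_1^2+\beta_1\right]+\alpha_1^2\left[\alpha_1^2+6\beta_1\right]+2\beta_0+\beta_1^2+\gamma_1,$$ $$c_3=4\alpha_0\alpha_1\left[3\alpha_0+\alpha_1^2+3\beta_1\right]+2\alpha_1\left[2\beta_0+\alpha_1^2\beta_1+\beta_1^2+\gamma_1\right],$$ $$c_2=2\alpha_0\left\{2\alpha_0^2+3\alpha_0\alpha_1^2+2\beta_0+3\left[\alpha_0+\alpha_1^2\right]\beta_1+\beta_1^2\right\}+2\alpha_1^2\beta_0+\left[2\beta_0+\alpha_1^2\beta_1\right]\beta_1+\left[2\alpha_0+\alpha_1^2+\beta_1\right]\gamma_1,$$ $$c_1=\alpha_1\left\{2\alpha_0\left[2\alpha_0^2+2\beta_0+(3\alpha_0+\beta_1)\beta_1\right]+2\beta_0\beta_1+(2\alpha_0+\beta_1)\gamma_1\right\},$$ $$c_0=\alpha_0\left\{\alpha_0^3+\alpha_0\left[2\beta_0+2\alpha_0\beta_1+\beta_1^2\right]+2\beta_0\beta_1+(\alpha_0+\beta_1)\gamma_1\right\}+\beta_0(\beta_0+\gamma_1)+\gamma_0.$$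 Then the $4$ parameters $\alpha_1,\beta_1,\gamma_0,\gamma_1$ are expressed as follows in terms of the $8$ coefficients $c_m$ and of the "free" parameters $\alpha_0$ and $\beta_0$: $$\alpha_1=\frac{c_7}{4},$$ $$\beta_1=-\frac{32\alpha_0-8c_6+3c_7^2}{16},$$ $$\gamma_0=c_0-\frac{1}{512}\left\{\alpha_0\left[8c_6-3c_7^2\right]-16\left[\alpha_0^2-\beta_0\right]\right\}\left\{c_7^4-8c_6^2+32c_4-2\alpha_0\left[8c_6-3c_7^2\right]+32\left[\alpha_0^2-\beta_0\right]\right\},$$ $$\gamma_1=-\alpha_0c_6+2\left[\alpha_0^2-\beta_0\right]+c_4+\frac{-8c_6^2+12\alpha_0c_7^2+c_7^4}{32},$$ while the $8$ coefficients $c_m$ satisfy the following $4$ constraints: $$c_5=\frac{c_7\left[24c_6-7c_7^2\right]}{32},$$ $$c_3=\frac{c_7\left[128c_4-20c_6c_7^2+7c_7^4\right]}{256},$$ $$c_2=\frac{512c_4\left[4c_6-c_7^2\right]-64\left[8c_6-3c_7^2\right]c_6^2+\left[16c_6-7c_7^2\right]c_7^4}{4096},$$ $$c_1=\frac{c_7\left[8c_6-3c_7^2\right]\left[32c_4-8c_6^2+c_7^4\right]}{2048}.$$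
   Context: All parameters and coefficients are complex numbers. *)

theory Defs
  imports Complex_Main "HOL-Computational_Algebra.Polynomial"
begin

end

theory Submission
  imports Defs
begin

text \<open>
  With \<open>Q = z^2 + \<alpha>1 z + \<alpha>0\<close> and \<open>R = Q^2 + \<beta>1 Q + \<beta>0\<close>, the eight formulas say that
  \<open>P = R^2 + \<gamma>1 R + \<gamma>0\<close>, so \<open>P\<close> is a threefold composition of monic quadratics.
  Such a decomposition is not unique: a constant may be shifted from the outcome of one
  quadratic into the next one. Shifting \<open>Q\<close> by a constant preserves \<open>u = 2 \<alpha>0 + \<beta>1\<close>,
  and shifting \<open>R\<close> preserves \<open>s = 2 w + \<gamma>1\<close>, where \<open>w\<close> is the constant term of \<open>R\<close>. Indeed
  \<open>R = z^4 + 2 \<alpha>1 z^3 + (\<alpha>1^2 + u) z^2 + \<alpha>1 u z + w\<close> and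
  \<open>P = (R - w)^2 + s (R - w) + (w^2 + \<gamma>1 w + \<gamma>0)\<close>,
  so the coefficients of positive degree depend on \<open>\<alpha>1\<close>, \<open>u\<close> and \<open>s\<close> alone.

  The coefficients of degree 7, 6 and 4 determine \<open>\<alpha>1\<close>, \<open>u\<close> and \<open>s\<close>, which turns those of
  degree 5, 3, 2 and 1 into functions of them: these are the four constraints. Choosing \<open>\<alpha>0\<close>
  and \<open>\<beta>0\<close> fixes the two shifts; then \<open>\<beta>1\<close> and \<open>\<gamma>1\<close> are read off from \<open>u\<close> and \<open>s\<close>, and
  \<open>\<gamma>0\<close> from the constant coefficient.
\<close>

theorem mainTheorem2:
  fixes P :: "complex poly"
    and c :: "nat \<Rightarrow> complex"
    and \<alpha>0 \<alpha>1 \<beta>0 \<beta>1 \<gamma>0 \<gamma>1 :: complex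
  assumes P: "P = monom 1 8 + (\<Sum>m=0..7. monom (c m) m)"
    and c7: "c 7 = 4 * \<alpha>1"
    and c6: "c 6 = 4 * \<alpha>0 + 6 * \<alpha>1^2 + 2 * \<beta>1"
    and c5: "c 5 = 12 * \<alpha>0 * \<alpha>1 + 4 * \<alpha>1^3 + 6 * \<alpha>1 * \<beta>1"
    and c4: "c 4 = 6 * \<alpha>0 * (\<alpha>0 + 2 * \<alpha>1^2 + \<beta>1) + \<alpha>1^2 * (\<alpha>1^2 + 6 * \<beta>1)
                     + 2 * \<beta>0 + \<beta>1^2 + \<gamma>1"
    and c3: "c 3 = 4 * \<alpha>0 * \<alpha>1 * (3 * \<alpha>0 + \<alpha>1^2 + 3 * \<beta>1)
                     + 2 * \<alpha>1 * (2 * \<beta>0 + \<alpha>1^2 * \<beta>1 + \<beta>1^2 + \<gamma>1)"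
    and c2: "c 2 = 2 * \<alpha>0 * (2 * \<alpha>0^2 + 3 * \<alpha>0 * \<alpha>1^2 + 2 * \<beta>0
                               + 3 * (\<alpha>0 + \<alpha>1^2) * \<beta>1 + \<beta>1^2)
                     + 2 * \<alpha>1^2 * \<beta>0 + (2 * \<beta>0 + \<alpha>1^2 * \<beta>1) * \<beta>1
                     + (2 * \<alpha>0 + \<alpha>1^2 + \<beta>1) * \<gamma>1"
    and c1: "c 1 = \<alpha>1 * (2 * \<alpha>0 * (2 * \<alpha>0^2 + 2 * \<beta>0 + (3 * \<alpha>0 + \<beta>1) * \<beta>1)
                           + 2 * \<beta>0 * \<beta>1 + (2 * \<alpha>0 + \<beta>1) * \<gamma>1)"
    and c0: "c 0 = \<alpha>0 * (\<alpha>0^3 + \<alpha>0 * (2 * \<beta>0 + 2 * \<alpha>0 * \<beta>1 + \<beta>1^2)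
                           + 2 * \<beta>0 * \<beta>1 + (\<alpha>0 + \<beta>1) * \<gamma>1)
                     + \<beta>0 * (\<beta>0 + \<gamma>1) + \<gamma>0"
  shows "\<alpha>1 = c 7 / 4
    \<and> \<beta>1 = - ((32 * \<alpha>0 - 8 * c 6 + 3 * (c 7)^2) / 16)
    \<and> \<gamma>0 = c 0 - 1 / 512
          * (\<alpha>0 * (8 * c 6 - 3 * (c 7)^2) - 16 * (\<alpha>0^2 - \<beta>0))
          * ((c 7)^4 - 8 * (c 6)^2 + 32 * c 4 - 2 * \<alpha>0 * (8 * c 6 - 3 * (c 7)^2)
              + 32 * (\<alpha>0^2 - \<beta>0))
    \<and> \<gamma>1 = - (\<alpha>0 * c 6) + 2 * (\<alpha>0^2 - \<beta>0) + c 4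
          + (- (8 * (c 6)^2) + 12 * \<alpha>0 * (c 7)^2 + (c 7)^4) / 32
    \<and> c 5 = c 7 * (24 * c 6 - 7 * (c 7)^2) / 32
    \<and> c 3 = c 7 * (128 * c 4 - 20 * c 6 * (c 7)^2 + 7 * (c 7)^4) / 256
    \<and> c 2 = (512 * c 4 * (4 * c 6 - (c 7)^2) - 64 * (8 * c 6 - 3 * (c 7)^2) * (c 6)^2
              + (16 * c 6 - 7 * (c 7)^2) * (c 7)^4) / 4096
    \<and> c 1 = c 7 * (8 * c 6 - 3 * (c 7)^2) * (32 * c 4 - 8 * (c 6)^2 + (c 7)^4) / 2048"
proof -
  define u where "u = 2 * \<alpha>0 + \<beta>1"
  define w where "w = \<alpha>0^2 + \<beta>1 * \<alpha>0 + \<beta>0"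
  define s where "s = 2 * w + \<gamma>1"
  note inv_defs = u_def w_def s_def
  note ring = power2_eq_square power3_eq_cube power4_eq_xxxx algebra_simps

  have d6: "c 6 = 6 * \<alpha>1^2 + 2 * u"
    unfolding c6 inv_defs by (simp add: ring)
  have d5: "c 5 = 4 * \<alpha>1^3 + 6 * \<alpha>1 * u"
    unfolding c5 inv_defs by (simp add: ring)
  have d4: "c 4 = \<alpha>1^4 + 6 * \<alpha>1^2 * u + u^2 + s"
    unfolding c4 inv_defs by (simp add: ring)
  have d3: "c 3 = 2 * \<alpha>1 * (u * (\<alpha>1^2 + u) + s)"
    unfolding c3 inv_defs by (simp add: ring)
  have d2: "c 2 = \<alpha>1^2 * u^2 + (\<alpha>1^2 + u) * s"
    unfolding c2 inv_defs by (simp add: ring)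
  have d1: "c 1 = \<alpha>1 * u * s"
    unfolding c1 inv_defs by (simp add: ring)
  have d0: "c 0 = w * (s - w) + \<gamma>0"
    unfolding c0 inv_defs by (simp add: ring)

  have u16: "8 * c 6 - 3 * (c 7)^2 = 16 * u"
    unfolding c7 d6 by (simp add: ring)
  have s32: "32 * c 4 - 8 * (c 6)^2 + (c 7)^4 = 32 * s"
    unfolding c7 d6 d4 by (simp add: ring)
  have w_u: "w = \<alpha>0 * u - (\<alpha>0^2 - \<beta>0)"
    unfolding inv_defs by (simp add: ring)

  have "\<alpha>1 = c 7 / 4"
    unfolding c7 by simp
  moreover have "\<beta>1 = - ((32 * \<alpha>0 - 8 * c 6 + 3 * (c 7)^2) / 16)"
  proof -
    have "32 * \<alpha>0 - 8 * c 6 + 3 * (c 7)^2 = 32 * \<alpha>0 - 16 * u"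
      unfolding u16[symmetric] by simp
    then show ?thesis
      unfolding u_def by simp
  qed
  moreover have "\<gamma>0 = c 0 - 1 / 512
          * (\<alpha>0 * (8 * c 6 - 3 * (c 7)^2) - 16 * (\<alpha>0^2 - \<beta>0))
          * ((c 7)^4 - 8 * (c 6)^2 + 32 * c 4 - 2 * \<alpha>0 * (8 * c 6 - 3 * (c 7)^2)
              + 32 * (\<alpha>0^2 - \<beta>0))"
  proof -
    \<comment> \<open>The two factors are \<open>16 w\<close> and \<open>32 (s - w)\<close>, whence \<open>512 = 16 * 32\<close>.\<close>
    have f1: "\<alpha>0 * (8 * c 6 - 3 * (c 7)^2) - 16 * (\<alpha>0^2 - \<beta>0) = 16 * w"
      unfolding u16 w_u by (simp add: algebra_simps)
    have "(c 7)^4 - 8 * (c 6)^2 + 32 * c 4 = 32 * s"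
      unfolding s32[symmetric] by simp
    then have f2: "(c 7)^4 - 8 * (c 6)^2 + 32 * c 4 - 2 * \<alpha>0 * (8 * c 6 - 3 * (c 7)^2)
        + 32 * (\<alpha>0^2 - \<beta>0) = 32 * (s - w)"
      unfolding u16 w_u by (simp add: algebra_simps)
    show ?thesis
      unfolding f1 f2 d0 by simp
  qed
  moreover have "\<gamma>1 = - (\<alpha>0 * c 6) + 2 * (\<alpha>0^2 - \<beta>0) + c 4
          + (- (8 * (c 6)^2) + 12 * \<alpha>0 * (c 7)^2 + (c 7)^4) / 32"
  proof -
    have "\<gamma>1 = s - 2 * \<alpha>0 * u + 2 * (\<alpha>0^2 - \<beta>0)"
      unfolding s_def w_u by (simp add: algebra_simps)
    also have "s = (32 * c 4 - 8 * (c 6)^2 + (c 7)^4) / 32"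
      unfolding s32 by simp
    also have "u = (8 * c 6 - 3 * (c 7)^2) / 16"
      unfolding u16 by simp
    finally show ?thesis
      by (simp add: algebra_simps add_divide_distrib diff_divide_distrib)
  qed
  moreover have "c 5 = c 7 * (24 * c 6 - 7 * (c 7)^2) / 32"
    unfolding d5 c7 d6 by (simp add: ring)
  moreover have "c 3 = c 7 * (128 * c 4 - 20 * c 6 * (c 7)^2 + 7 * (c 7)^4) / 256"
    unfolding d3 c7 d6 d4 by (simp add: ring)
  moreover have "c 2 = (512 * c 4 * (4 * c 6 - (c 7)^2)
              - 64 * (8 * c 6 - 3 * (c 7)^2) * (c 6)^2
              + (16 * c 6 - 7 * (c 7)^2) * (c 7)^4) / 4096"
    unfolding d2 c7 d6 d4 by (simp add: ring)
  moreover have "c 1 = c 7 * (8 * c 6 - 3 * (c 7)^2)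
              * (32 * c 4 - 8 * (c 6)^2 + (c 7)^4) / 2048"
    unfolding u16 s32 unfolding d1 c7 by simp
  ultimately show ?thesis
    by blast
qed

end
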